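(* Let $n$ be a nonnegative integer and let $\mathbf{m}=(m_0,m_1,\dots,m_n)\in\mathbb{R}^{n+1}$. Let $\mathrm{Quad}_+(\mathbf{m})$ be the convex set of all positive quadratures $\mathcal{Q}$ on $[-1,1]$ satisfying $\mathcal{Q}[e_k]=m_k$ for $k=0,1,\dots,n$, where $e_k(x)=x^k$. Then a quadrature $\mathcal{Q}\in\mathrm{Quad}_+(\mathbf{m})$ is an extreme point of $\mathrm{Quad}_+(\mathbf{m})$ if and only if $n(\mathcal{Q})\le n+1$, where $n(\mathcal{Q})$ is the number of nodes of $\mathcal{Q}$.
   Context: A quadrature on $[-1,1]$ is a linear functional on the space $\mathbb{R}^{[-1,1]}$ of all functions $f:[-1,1]\to\mathbb{R}$ of the form $\mathcal{Q}[f]=\sum_{k=1}^{n(\mathcal{Q})} w_k f(\xi_k)$, where $n(\mathcal{Q})\in\mathbb{N}=\{1,2,\dots\}$, the $\xi_k\in[-1,1]$ are pairwise distinct (the nodes) and the $w_k$ are real numbers (the weights). It is a positive quadrature if all its weights satisfy $w_k>0$. A point $x$ of a convex set $D$ in a real linear space is an extreme point of $D$ if $x=tu+(1-t)v$ with $u,v\in D$ and $t\in(0,1)$ implies $u=v=x$. *)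

theory Defs
  imports "HOL-Analysis.Analysis" "HOL-Library.Function_Algebras"
begin

text \<open>Pointwise real vector space structure on functions, completing the additive structure
  of \<^theory>\<open>HOL-Library.Function_Algebras\<close>; with it, the library notions \<^const>\<open>convex\<close>,
  \<^const>\<open>linear\<close> and \<^const>\<open>extreme_point_of\<close> apply to functionals.\<close>

instantiation "fun" :: (type, real_vector) real_vector
begin

definition scaleR_fun :: "real \<Rightarrow> ('a \<Rightarrow> 'b) \<Rightarrow> 'a \<Rightarrow> 'b"
  where "scaleR_fun c f = (\<lambda>x. c *\<^sub>R f x)"

instance
  by standard (auto simp: scaleR_fun_def fun_eq_iff scaleR_add_right scaleR_add_left)

end

lemma scaleR_fun_apply [simp]: "(c *\<^sub>R f) x = c *\<^sub>R f x"
  by (simp add: scaleR_fun_def)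

typedef ival = "{-1..1::real}"
  by (rule exI[of _ 0]) simp

declare [[coercion Rep_ival]]

type_synonym functional = "(ival \<Rightarrow> real) \<Rightarrow> real"

definition quadrature_rep :: "nat \<Rightarrow> (nat \<Rightarrow> ival) \<Rightarrow> (nat \<Rightarrow> real) \<Rightarrow> functional \<Rightarrow> bool"
  where "quadrature_rep N \<xi> w Q \<longleftrightarrow>
    N \<ge> 1 \<and> inj_on \<xi> {1..N} \<and> Q = (\<lambda>f. \<Sum>k=1..N. w k * f (\<xi> k))"

definition positive_quadrature_rep ::
    "nat \<Rightarrow> (nat \<Rightarrow> ival) \<Rightarrow> (nat \<Rightarrow> real) \<Rightarrow> functional \<Rightarrow> bool"
  where "positive_quadrature_rep N \<xi> w Q \<longleftrightarrow>
    quadrature_rep N \<xi> w Q \<and> (\<forall>k\<in>{1..N}. w k > 0)"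

definition positive_quadrature :: "functional \<Rightarrow> bool"
  where "positive_quadrature Q \<longleftrightarrow> (\<exists>N \<xi> w. positive_quadrature_rep N \<xi> w Q)"

text \<open>The number of nodes is a function of the functional because the representation of a positive
  quadrature is unique up to reordering; see \<open>num_nodes_eq\<close> below. (Without positivity, nodes of
  weight zero could be added or removed.)\<close>

definition num_nodes :: "functional \<Rightarrow> nat"
  where "num_nodes Q = (THE N. \<exists>\<xi> w. positive_quadrature_rep N \<xi> w Q)"

definition power_fun :: "nat \<Rightarrow> ival \<Rightarrow> real"
  where "power_fun k = (\<lambda>x. x ^ k)"

text \<open>Only the entries \<open>m 0, \<dots>, m n\<close> of the sequence \<open>m\<close> are used.\<close>

definition Quad_plus :: "nat \<Rightarrow> (nat \<Rightarrow> real) \<Rightarrow> functional set"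
  where "Quad_plus n m = {Q. positive_quadrature Q \<and> (\<forall>k\<in>{0..n}. Q (power_fun k) = m k)}"

lemma quadrature_rep_linear:
  assumes "quadrature_rep N \<xi> w Q"
  shows "linear Q"
  using assms unfolding quadrature_rep_def
  by (intro linearI) (auto simp: sum.distrib sum_distrib_left algebra_simps)

lemma positive_quadrature_rep_set:
  assumes "positive_quadrature_rep N \<xi> w Q"
  obtains X v where "finite X" "card X = N" "X \<noteq> {}" "\<And>x. x \<in> X \<Longrightarrow> v x > 0"
    "\<And>f. Q f = (\<Sum>x\<in>X. v x * f x)"
proof
  have N: "N \<ge> 1" and inj: "inj_on \<xi> {1..N}"
    and Q: "Q = (\<lambda>f. \<Sum>k=1..N. w k * f (\<xi> k))" and pos: "\<forall>k\<in>{1..N}. w k > 0"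
    using assms by (auto simp: positive_quadrature_rep_def quadrature_rep_def)
  let ?X = "\<xi> ` {1..N}" and ?v = "\<lambda>x. w (inv_into {1..N} \<xi> x)"
  show "finite ?X" "?X \<noteq> {}" using N by auto
  show "card ?X = N" using card_image[OF inj] by simp
  show "?v x > 0" if "x \<in> ?X" for x using that pos inj by auto
  show "Q f = (\<Sum>x\<in>?X. ?v x * f x)" for f
    unfolding Q sum.reindex[OF inj] by (rule sum.cong) (use inj in auto)
qed

lemma positive_quadrature_iff_set:
  "positive_quadrature Q \<longleftrightarrow> (\<exists>X v. finite X \<and> X \<noteq> {} \<and> (\<forall>x\<in>X. v x > 0) \<and>
     Q = (\<lambda>f. \<Sum>x\<in>X. v x * f x))"
proof
  assume "positive_quadrature Q"
  then obtain N \<xi> w where "positive_quadrature_rep N \<xi> w Q"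
    by (auto simp: positive_quadrature_def)
  then obtain X v where "finite X" "X \<noteq> {}" "\<And>x. x \<in> X \<Longrightarrow> v x > 0"
    "\<And>f. Q f = (\<Sum>x\<in>X. v x * f x)"
    by (rule positive_quadrature_rep_set) blast
  then show "\<exists>X v. finite X \<and> X \<noteq> {} \<and> (\<forall>x\<in>X. v x > 0) \<and> Q = (\<lambda>f. \<Sum>x\<in>X. v x * f x)"
    by (intro exI[of _ X] exI[of _ v]) auto
next
  assume "\<exists>X v. finite X \<and> X \<noteq> {} \<and> (\<forall>x\<in>X. v x > 0) \<and> Q = (\<lambda>f. \<Sum>x\<in>X. v x * f x)"
  then obtain X v where X: "finite X" "X \<noteq> {}" "\<forall>x\<in>X. v x > 0"
    and Q: "Q = (\<lambda>f. \<Sum>x\<in>X. v x * f x)" by blast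
  obtain \<xi> where \<xi>: "bij_betw \<xi> {1..card X} X"
    using ex_bij_betw_nat_finite_1[OF X(1)] by blast
  have "positive_quadrature_rep (card X) \<xi> (v \<circ> \<xi>) Q"
    unfolding positive_quadrature_rep_def quadrature_rep_def
  proof (intro conjI ballI)
    show "1 \<le> card X" using X by (simp add: Suc_le_eq card_gt_0_iff)
    show "inj_on \<xi> {1..card X}" using \<xi> by (simp add: bij_betw_def)
    show "Q = (\<lambda>f. \<Sum>k=1..card X. (v \<circ> \<xi>) k * f (\<xi> k))"
      unfolding Q fun_eq_iff by (simp add: sum.reindex_bij_betw[OF \<xi>, symmetric])
    show "0 < (v \<circ> \<xi>) k" if "k \<in> {1..card X}" for k
      using that X(3) bij_betwE[OF \<xi>] by simp
  qed
  then show "positive_quadrature Q" by (auto simp: positive_quadrature_def)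
qed

lemma num_nodes_eq:
  assumes "positive_quadrature_rep N \<xi> w Q"
  shows "num_nodes Q = N"
proof -
  have *: "M = card {x. Q (\<lambda>y. if y = x then 1 else 0) \<noteq> 0}"
    if rep: "positive_quadrature_rep M \<eta> u Q" for M \<eta> u
  proof -
    obtain X v where X: "finite X" "card X = M" "\<And>x. x \<in> X \<Longrightarrow> v x > 0"
      and Q: "\<And>f. Q f = (\<Sum>x\<in>X. v x * f x)"
      using positive_quadrature_rep_set[OF rep] by blast
    have "Q (\<lambda>y. if y = x then 1 else 0) = (if x \<in> X then v x else 0)" for x
      unfolding Q using X(1) by (simp add: if_distrib sum.delta cong: if_cong)
    then have "{x. Q (\<lambda>y. if y = x then 1 else 0) \<noteq> 0} = X"
      using X(3) by (force simp: less_le)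
    then show ?thesis using X(2) by simp
  qed
  show ?thesis
    unfolding num_nodes_def
  proof (rule the_equality)
    show "\<exists>\<xi> w. positive_quadrature_rep N \<xi> w Q" using assms by blast
    show "M = N" if "\<exists>\<xi> w. positive_quadrature_rep M \<xi> w Q" for M
      using that *[OF assms] * by blast
  qed
qed

lemma convex_Quad_plus: "convex (Quad_plus n m)"
  unfolding convex_alt
proof (intro ballI allI impI)
  fix P Q :: functional and t :: real
  assume PQ: "P \<in> Quad_plus n m" "Q \<in> Quad_plus n m" and t: "0 \<le> t \<and> t \<le> 1"
  have "positive_quadrature ((1 - t) *\<^sub>R P + t *\<^sub>R Q)"
  proof (cases "t = 0 \<or> t = 1")
    case True
    then show ?thesis using PQ by (auto simp: Quad_plus_def)
  next
    case False
    obtain X v where X: "finite X" "X \<noteq> {}" "\<forall>x\<in>X. v x > 0"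
      and P: "P = (\<lambda>f. \<Sum>x\<in>X. v x * f x)"
      using PQ(1) by (auto simp: Quad_plus_def positive_quadrature_iff_set)
    obtain Y u where Y: "finite Y" "Y \<noteq> {}" "\<forall>x\<in>Y. u x > 0"
      and Q: "Q = (\<lambda>f. \<Sum>x\<in>Y. u x * f x)"
      using PQ(2) by (auto simp: Quad_plus_def positive_quadrature_iff_set)
    define w where
      "w x = (if x \<in> X then (1 - t) * v x else 0) + (if x \<in> Y then t * u x else 0)" for x
    have pos: "w x > 0" if "x \<in> X \<union> Y" for x
      using that X(3) Y(3) t False by (auto simp: w_def intro!: add_pos_pos)
    have "((1 - t) *\<^sub>R P + t *\<^sub>R Q) f = (\<Sum>x\<in>X\<union>Y. w x * f x)" for f
    proof -
      have "(1 - t) * P f = (\<Sum>x\<in>X\<union>Y. (if x \<in> X then (1 - t) * v x else 0) * f x)"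
        unfolding P sum_distrib_left
        by (rule sum.mono_neutral_cong_left) (use X(1) Y(1) in auto)
      moreover have "t * Q f = (\<Sum>x\<in>X\<union>Y. (if x \<in> Y then t * u x else 0) * f x)"
        unfolding Q sum_distrib_left
        by (rule sum.mono_neutral_cong_left) (use X(1) Y(1) in auto)
      ultimately show ?thesis
        by (simp add: w_def distrib_right sum.distrib)
    qed
    then have "(1 - t) *\<^sub>R P + t *\<^sub>R Q = (\<lambda>f. \<Sum>x\<in>X\<union>Y. w x * f x)"
      by (simp add: fun_eq_iff)
    then show ?thesis
      unfolding positive_quadrature_iff_set using X(1,2) Y(1) pos
      by (intro exI[of _ "X \<union> Y"] exI[of _ w]) auto
  qed
  moreover have "((1 - t) *\<^sub>R P + t *\<^sub>R Q) (power_fun k) = m k" if "k \<in> {0..n}" for k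
    using PQ that by (simp add: Quad_plus_def algebra_simps)
  ultimately show "(1 - t) *\<^sub>R P + t *\<^sub>R Q \<in> Quad_plus n m"
    by (simp add: Quad_plus_def)
qed

lemma extreme_point_of_functional_iff:
  fixes D :: "functional set"
  shows "Q extreme_point_of D \<longleftrightarrow> Q \<in> D \<and>
    (\<forall>U\<in>D. \<forall>V\<in>D. \<forall>t\<in>{0<..<1}. Q = t *\<^sub>R U + (1 - t) *\<^sub>R V \<longrightarrow> U = Q \<and> V = Q)"
    (is "_ \<longleftrightarrow> _ \<and> ?R")
proof -
  have seg: "Q \<in> open_segment U V \<longleftrightarrow> U \<noteq> V \<and> (\<exists>t\<in>{0<..<1}. Q = t *\<^sub>R U + (1 - t) *\<^sub>R V)"
    for U V
  proof -
    have "Q \<in> open_segment V U \<longleftrightarrow> V \<noteq> U \<and> (\<exists>t\<in>{0<..<1}. Q = (1 - t) *\<^sub>R V + t *\<^sub>R U)"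
      unfolding in_segment by auto
    then show ?thesis by (auto simp: open_segment_commute add.commute)
  qed
  have "(\<forall>U\<in>D. \<forall>V\<in>D. Q \<notin> open_segment U V) \<longleftrightarrow> ?R"
  proof
    assume L: "\<forall>U\<in>D. \<forall>V\<in>D. Q \<notin> open_segment U V"
    show ?R
    proof (intro ballI impI)
      fix U V t assume *: "U \<in> D" "V \<in> D" "t \<in> {0<..<1::real}" "Q = t *\<^sub>R U + (1 - t) *\<^sub>R V"
      then have "U = V" using L seg by blast
      then show "U = Q \<and> V = Q" using *(4) by (simp flip: scaleR_add_left)
    qed
  next
    assume ?R then show "\<forall>U\<in>D. \<forall>V\<in>D. Q \<notin> open_segment U V" using seg by metis
  qed
  then show ?thesis by (simp add: extreme_point_of_def)
qed

end

theory Submission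
  imports Defs
begin

text \<open>Write \<open>Q f = (\<Sum>x\<in>X. v x * f x)\<close>. If \<open>Q\<close> is a proper convex combination of two positive
  quadratures, testing on indicator functions of points outside \<open>X\<close> shows that both are supported
  on \<open>X\<close>; for \<open>card X \<le> n + 1\<close> the moments then determine the weights (Vandermonde). If
  \<open>card X > n + 1\<close>, some nontrivial \<open>c\<close> on \<open>X\<close> has vanishing moments up to order \<open>n\<close>,
  and \<open>Q\<close> is the midpoint of the quadratures with weights \<open>v \<plusminus> \<epsilon> c\<close> for small \<open>\<epsilon>\<close>.\<close>

text \<open>Injectivity of the Vandermonde system, by removing one node \<open>x0\<close> at a time:
  weights multiplied by \<open>g x - g x0\<close> no longer see \<open>x0\<close>, and their moment
  of order \<open>k\<close> combines the old ones of orders \<open>k\<close> and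
  \<open>k + 1\<close>. One node is thus traded for one moment.\<close>

lemma sum_moments_eq_0_imp_eq_0:
  fixes g :: "'a \<Rightarrow> 'b :: field"
  assumes "finite X" "inj_on g X" "card X \<le> d" "\<And>k. k < d \<Longrightarrow> (\<Sum>x\<in>X. c x * g x ^ k) = 0"
    and "x \<in> X"
  shows "c x = 0"
  using assms
proof (induction X arbitrary: c d x rule: finite_induct)
  case empty
  then show ?case by simp
next
  case (insert x0 X)
  obtain d' where d: "d = Suc d'" and d': "card X \<le> d'"
    using insert.prems(2) insert.hyps by (cases d) auto
  have "(\<Sum>x\<in>X. (c x * (g x - g x0)) * g x ^ k) = 0" if "k < d'" for k
  proof -
    have "(\<Sum>x\<in>X. (c x * (g x - g x0)) * g x ^ k)
        = (\<Sum>x\<in>insert x0 X. (c x * (g x - g x0)) * g x ^ k)"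
      using insert.hyps by simp
    also have "\<dots> = (\<Sum>x\<in>insert x0 X. c x * g x ^ Suc k) - g x0 * (\<Sum>x\<in>insert x0 X. c x * g x ^ k)"
      unfolding sum_distrib_left sum_subtractf[symmetric]
      by (rule sum.cong) (auto simp: algebra_simps)
    also have "\<dots> = 0"
      using that d insert.prems(3)[of "Suc k"] insert.prems(3)[of k] by simp
    finally show ?thesis .
  qed
  then have "c y * (g y - g x0) = 0" if "y \<in> X" for y
    using insert.IH[of d' "\<lambda>x. c x * (g x - g x0)" y] insert.prems(1) d' that by simp
  moreover have "g y \<noteq> g x0" if "y \<in> X" for y
    using insert.prems(1) insert.hyps that by (auto simp: inj_on_def)
  ultimately have X: "\<forall>y\<in>X. c y = 0" by auto
  \<comment> \<open>Only the term at \<open>x0\<close> is left in the moment of order 0.\<close>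
  then have "c x0 = 0"
    using insert.prems(3)[of 0] insert.hyps d by simp
  then show ?case using X insert.prems(4) by auto
qed

text \<open>The node removal above, run backwards: dividing by \<open>g x - g x0\<close> and adding
  a node \<open>x0\<close> gains one vanishing moment.\<close>

lemma ex_nontrivial_sum_moments_eq_0:
  fixes g :: "'a \<Rightarrow> 'b :: field"
  assumes "finite X" "inj_on g X" "d < card X"
  shows "\<exists>c. (\<exists>x\<in>X. c x \<noteq> 0) \<and> (\<forall>k<d. (\<Sum>x\<in>X. c x * g x ^ k) = 0)"
  using assms
proof (induction d arbitrary: X)
  case 0
  then have "X \<noteq> {}" by auto
  then show ?case by (intro exI[of _ "\<lambda>_. 1"]) auto
next
  case (Suc d)
  then obtain x0 where x0: "x0 \<in> X" by fastforce
  define X' where "X' = X - {x0}"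
  have X: "X = insert x0 X'" "x0 \<notin> X'" "finite X'"
    using x0 Suc.prems by (auto simp: X'_def)
  have "inj_on g X'" "d < card X'"
    using Suc.prems X by auto
  from Suc.IH[OF X(3) this] obtain c
    where c: "\<exists>x\<in>X'. c x \<noteq> 0" and mom: "\<And>k. k < d \<Longrightarrow> (\<Sum>x\<in>X'. c x * g x ^ k) = 0"
    by blast
  have ne: "g x - g x0 \<noteq> 0" if "x \<in> X'" for x
    using Suc.prems(2) X that by (auto simp: inj_on_def)
  define s where "s = (\<Sum>x\<in>X'. c x / (g x - g x0))"
  \<comment> \<open>The weight \<open>- s\<close> at \<open>x0\<close> cancels the moment of order
    0. Higher orders follow recursively: the moment of \<open>b\<close> of order
    \<open>k + 1\<close> is \<open>g x0\<close> times that of order \<open>k\<close>, plus the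
    moment of \<open>c\<close> of order \<open>k\<close>, which is zero.\<close>
  define b where "b x = (if x = x0 then - s else c x / (g x - g x0))" for x
  have b: "b x0 = - s" "\<And>x. x \<in> X' \<Longrightarrow> b x = c x / (g x - g x0)"
    using X(2) by (auto simp: b_def)
  have "(\<Sum>x\<in>X. b x * g x ^ k) = 0" if "k < Suc d" for k
    using that
  proof (induction k)
    case 0
    then show ?case using X b by (simp add: s_def)
  next
    case (Suc k)
    have "(\<Sum>x\<in>X. b x * g x ^ Suc k) - g x0 * (\<Sum>x\<in>X. b x * g x ^ k)
        = (\<Sum>x\<in>X. b x * (g x - g x0) * g x ^ k)"
      unfolding sum_distrib_left sum_subtractf[symmetric]
      by (rule sum.cong) (auto simp: algebra_simps)
    also have "\<dots> = (\<Sum>x\<in>X'. b x * (g x - g x0) * g x ^ k)"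
      using X by simp
    also have "\<dots> = (\<Sum>x\<in>X'. c x * g x ^ k)"
      using b ne by (intro sum.cong) auto
    also have "\<dots> = 0" using mom Suc.prems by simp
    finally show ?case using Suc by simp
  qed
  moreover have "\<exists>x\<in>X. b x \<noteq> 0"
    using c b ne X(1) by (metis divide_eq_0_iff insertI2)
  ultimately show ?case by blast
qed

lemma positive_quadrature_nonneg:
  assumes "positive_quadrature Q" "\<And>x. f x \<ge> 0"
  shows "Q f \<ge> 0"
  using assms unfolding positive_quadrature_iff_set
  by (auto intro!: sum_nonneg mult_nonneg_nonneg simp: less_imp_le)

lemma sum_mult_of_bool_eq:
  fixes v :: "'a \<Rightarrow> real"
  assumes "finite X"
  shows "(\<Sum>x\<in>X. v x * of_bool (x = y)) = (if y \<in> X then v y else 0)"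
  using assms by (simp add: of_bool_def if_distrib cong: if_cong)

lemma convex_combination_supported:
  assumes U: "positive_quadrature U" and V: "positive_quadrature V"
    and t: "0 < t" "t < 1"
    and Q: "\<And>f. t * U f + (1 - t) * V f = (\<Sum>x\<in>X. v x * f x)" and "finite X"
  obtains u where "\<And>f. U f = (\<Sum>x\<in>X. u x * f x)"
proof -
  obtain Y u where Y: "finite Y" "\<forall>x\<in>Y. u x > 0" and U_eq: "U = (\<lambda>f. \<Sum>x\<in>Y. u x * f x)"
    using U by (auto simp: positive_quadrature_iff_set)
  have "Y \<subseteq> X"
  proof
    fix y assume y: "y \<in> Y"
    show "y \<in> X"
    proof (rule ccontr)
      assume "y \<notin> X"
      then have "t * U (\<lambda>x. of_bool (x = y)) + (1 - t) * V (\<lambda>x. of_bool (x = y)) = 0"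
        unfolding Q using \<open>finite X\<close> by (simp add: sum_mult_of_bool_eq)
      moreover have "U (\<lambda>x. of_bool (x = y)) > 0"
        using y Y by (simp add: U_eq sum_mult_of_bool_eq)
      moreover have "V (\<lambda>x. of_bool (x = y)) \<ge> 0"
        by (rule positive_quadrature_nonneg[OF V]) simp
      ultimately show False
        using t by (smt (verit) mult_nonneg_nonneg mult_pos_pos)
    qed
  qed
  \<comment> \<open>Extending the weights by zero from \<open>Y\<close> to \<open>X\<close> puts
    different functionals on one node set, at the price of positivity.\<close>
  then have "U f = (\<Sum>x\<in>X. (if x \<in> Y then u x else 0) * f x)" for f
    unfolding U_eq using \<open>finite X\<close> by (intro sum.mono_neutral_cong_left) auto
  then show thesis by (rule that)
qed

text \<open>The difference \<open>u - v\<close> has \<open>n + 1\<close> vanishing moments on at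
  most \<open>n + 1\<close> nodes. Signs of the weights do not enter, so zeros of \<open>u\<close>
  on \<open>X\<close> are harmless.\<close>

lemma Quad_plus_eqI:
  assumes "finite X" "card X \<le> n + 1" "U \<in> Quad_plus n m" "Q \<in> Quad_plus n m"
    and U: "\<And>f. U f = (\<Sum>x\<in>X. u x * f x)" and Q: "\<And>f. Q f = (\<Sum>x\<in>X. v x * f x)"
  shows "U = Q"
proof -
  have "(\<Sum>x\<in>X. (u x - v x) * Rep_ival x ^ k) = 0" if "k < n + 1" for k
  proof -
    have "U (power_fun k) = Q (power_fun k)"
      using assms(3,4) that by (simp add: Quad_plus_def)
    then show ?thesis
      by (simp add: U Q power_fun_def left_diff_distrib sum_subtractf)
  qed
  moreover have "inj_on Rep_ival X"
    by (simp add: inj_on_def Rep_ival_inject)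
  ultimately have "u x - v x = 0" if "x \<in> X" for x
    using sum_moments_eq_0_imp_eq_0[of X Rep_ival "n + 1" "\<lambda>x. u x - v x"] assms(1,2) that
    by blast
  then show ?thesis by (auto simp: fun_eq_iff U Q intro!: sum.cong)
qed

lemma ex_small_perturbation:
  fixes v c :: "'a \<Rightarrow> real"
  assumes "finite X" "\<And>x. x \<in> X \<Longrightarrow> v x > 0"
  obtains e where "e > 0" "\<And>x. x \<in> X \<Longrightarrow> e * \<bar>c x\<bar> < v x"
proof -
  have "\<exists>e>0. \<forall>x\<in>X. e * \<bar>c x\<bar> < v x"
    using assms
  proof (induction X rule: finite_induct)
    case empty
    show ?case by (auto intro: exI[of _ 1])
  next
    case (insert y X)
    then obtain e where e: "e > 0" "\<forall>x\<in>X. e * \<bar>c x\<bar> < v x" by auto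
    \<comment> \<open>The summand 1 avoids division by zero where \<open>c y = 0\<close> and makes
      the bound strict: \<open>e' * \<bar>c y\<bar>\<close> is at most
      \<open>v y - e'\<close>.\<close>
    define e' where "e' = min e (v y / (\<bar>c y\<bar> + 1))"
    have vy: "v y > 0" using insert.prems by simp
    have "e' > 0" using e vy by (simp add: e'_def)
    moreover have "e' * \<bar>c x\<bar> < v x" if "x \<in> X" for x
      using e that mult_right_mono[of e' e "\<bar>c x\<bar>"] by (force simp: e'_def)
    moreover have "e' * (\<bar>c y\<bar> + 1) \<le> v y"
      using mult_right_mono[of e' "v y / (\<bar>c y\<bar> + 1)" "\<bar>c y\<bar> + 1"] by (simp add: e'_def)
    then have "e' * \<bar>c y\<bar> < v y" using \<open>e' > 0\<close> by (simp add: distrib_left)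
    ultimately show ?case by (intro exI[of _ e']) auto
  qed
  then show thesis using that by blast
qed

lemma not_extreme_point_if_card_gt:
  assumes X: "finite X" "n + 1 < card X" "\<And>x. x \<in> X \<Longrightarrow> v x > 0"
    and Qin: "Q \<in> Quad_plus n m" and Q: "\<And>f. Q f = (\<Sum>x\<in>X. v x * f x)"
  shows "\<not> Q extreme_point_of Quad_plus n m"
proof
  assume ext: "Q extreme_point_of Quad_plus n m"
  have "inj_on Rep_ival X"
    by (simp add: inj_on_def Rep_ival_inject)
  from ex_nontrivial_sum_moments_eq_0[OF X(1) this X(2)] obtain c y
    where y: "y \<in> X" "c y \<noteq> 0" and mom: "\<And>k. k \<le> n \<Longrightarrow> (\<Sum>x\<in>X. c x * Rep_ival x ^ k) = 0"
    by (auto simp: less_Suc_eq_le)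
  obtain e where e: "e > 0" "\<And>x. x \<in> X \<Longrightarrow> e * \<bar>c x\<bar> < v x"
    using ex_small_perturbation[of X v c, OF X(1,3)] by blast
  \<comment> \<open>A line through \<open>Q = P 0\<close> along which the prescribed moments stay
    constant; the choice of \<open>e\<close> keeps all weights positive at \<open>s = e\<close> and
    \<open>s = - e\<close>.\<close>
  define P :: "real \<Rightarrow> functional" where "P s = (\<lambda>f. \<Sum>x\<in>X. (v x + s * c x) * f x)" for s
  have P_eq: "P s f = Q f + s * (\<Sum>x\<in>X. c x * f x)" for s f
    by (simp add: P_def Q distrib_right sum.distrib sum_distrib_left mult.assoc)
  have P_in: "P s \<in> Quad_plus n m" if "\<bar>s\<bar> = e" for s
  proof -
    have "v x + s * c x > 0" if "x \<in> X" for x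
    proof -
      have "\<bar>s * c x\<bar> < v x" using e(2)[OF that] \<open>\<bar>s\<bar> = e\<close> by (simp add: abs_mult)
      then show ?thesis by linarith
    qed
    then have "positive_quadrature (P s)"
      unfolding positive_quadrature_iff_set P_def using X(1) y(1)
      by (intro exI[of _ X] exI[of _ "\<lambda>x. v x + s * c x"]) auto
    moreover have "P s (power_fun k) = m k" if "k \<in> {0..n}" for k
      using that Qin mom[of k] by (simp add: P_eq Quad_plus_def power_fun_def)
    ultimately show ?thesis by (simp add: Quad_plus_def)
  qed
  have "Q = (1/2) *\<^sub>R P e + (1 - 1/2) *\<^sub>R P (- e)"
    by (simp add: fun_eq_iff P_eq field_simps)
  moreover have "P e \<in> Quad_plus n m" "P (- e) \<in> Quad_plus n m" "1/2 \<in> {0<..<1::real}"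
    using P_in e(1) by auto
  ultimately have "P e = Q"
    using ext unfolding extreme_point_of_functional_iff by blast
  \<comment> \<open>The indicator of \<open>y\<close> reads off the change \<open>e * c y\<close> of
    the weight at \<open>y\<close>, which is nonzero.\<close>
  then have "e * c y = 0"
    using P_eq[of e "\<lambda>x. of_bool (x = y)"] X(1) y(1) by (simp add: sum_mult_of_bool_eq)
  then show False using e(1) y(2) by simp
qed

theorem theorem1:
  fixes n :: nat and m :: "nat \<Rightarrow> real" and Q :: functional
  assumes "Q \<in> Quad_plus n m"
  shows "Q extreme_point_of (Quad_plus n m) \<longleftrightarrow> num_nodes Q \<le> n + 1"
proof -
  obtain N \<xi> w where rep: "positive_quadrature_rep N \<xi> w Q"
    using assms by (auto simp: Quad_plus_def positive_quadrature_def)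
  obtain X v where X: "finite X" "card X = N" "\<And>x. x \<in> X \<Longrightarrow> v x > 0"
    and Q: "\<And>f. Q f = (\<Sum>x\<in>X. v x * f x)"
    using positive_quadrature_rep_set[OF rep] by blast
  have card: "num_nodes Q = card X"
    using num_nodes_eq[OF rep] X(2) by simp
  show ?thesis
  proof
    assume "Q extreme_point_of Quad_plus n m"
    then show "num_nodes Q \<le> n + 1"
      using not_extreme_point_if_card_gt[OF X(1) _ X(3) assms Q] card by fastforce
  next
    assume le: "num_nodes Q \<le> n + 1"
    \<comment> \<open>It suffices to treat the first summand: exchanging \<open>U\<close> with
      \<open>V\<close> and \<open>t\<close> with \<open>1 - t\<close> gives the second.\<close>
    have *: "U = Q" if UV: "U \<in> Quad_plus n m" "V \<in> Quad_plus n m" and t: "0 < t" "t < 1"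
      and eq: "Q = t *\<^sub>R U + (1 - t) *\<^sub>R V" for U V t
    proof -
      have "positive_quadrature U" "positive_quadrature V"
        using UV by (auto simp: Quad_plus_def)
      moreover have "t * U f + (1 - t) * V f = (\<Sum>x\<in>X. v x * f x)" for f
        using Q[of f] by (simp add: eq)
      ultimately obtain u where "\<And>f. U f = (\<Sum>x\<in>X. u x * f x)"
        using convex_combination_supported[OF _ _ t _ X(1)] by metis
      then show ?thesis
        using Quad_plus_eqI[OF X(1) _ UV(1) assms _ Q] le card by metis
    qed
    show "Q extreme_point_of Quad_plus n m"
      unfolding extreme_point_of_functional_iff
    proof (intro conjI ballI impI)
      fix U V and t :: real
      assume UV: "U \<in> Quad_plus n m" "V \<in> Quad_plus n m" and t: "t \<in> {0<..<1}"
        and eq: "Q = t *\<^sub>R U + (1 - t) *\<^sub>R V"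
      show "U = Q" using *[OF UV _ _ eq] t by simp
      show "V = Q" using *[OF UV(2,1), of "1 - t"] t eq by (simp add: add.commute)
    qed (rule assms)
  qed
qed

end
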